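(* Let $p$ be a prime number. For every $\lambda\in\overline{\mathbb{Q}}$ with $\lambda\neq 0$ and $\nu_p(\lambda)\neq 0$, the Belyi height of $\lambda$ satisfies $\mathcal{H}(\lambda)\geq p$.
   Context: Fix a prime $p$, an algebraic closure $\overline{\mathbb{Q}}_p$ of the field $\mathbb{Q}_p$ of $p$-adic numbers, and an algebraic closure $\overline{\mathbb{Q}}$ of $\mathbb{Q}$ embedded in $\overline{\mathbb{Q}}_p$. Let $\nu_p:\overline{\mathbb{Q}}_p\to\mathbb{R}\cup\{\infty\}$ be the $p$-adic valuation, i.e. the extension to $\overline{\mathbb{Q}}_p$ of the usual $p$-adic valuation on $\mathbb{Q}$ (with $\nu_p(p)=1$ and $\nu_p(0)=\infty$). A (normalized) Belyi polynomial is a nonconstant polynomial $B(x)\in\overline{\mathbb{Q}}[x]$ such that $B(0),B(1)\in\{0,1\}$ and $\{B(x_i): B'(x_i)=0\}\subset\{0,1\}$, i.e. every critical value of $B$ is $0$ or $1$. For $\lambda\in\overline{\mathbb{Q}}$, the Belyi height $\mathcal{H}(\lambda)$ is the minimal degree of a normalized Belyi polynomial $B$ with $B(\lambda)\in\{0,1\}$ (such a polynomial exists for every $\lambda\in\overline{\mathbb{Q}}$, by Belyi's construction). *)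

theory Defs
  imports "HOL-Computational_Algebra.Computational_Algebra" "HOL-Library.Extended_Real"
begin

definition field_embedding :: "('a :: field \<Rightarrow> 'b :: field) \<Rightarrow> bool" where
  "field_embedding f \<longleftrightarrow>
     f 1 = 1 \<and> (\<forall>x y. f (x + y) = f x + f y) \<and> (\<forall>x y. f (x * y) = f x * f y)"

(* The class alg_closed_field provides algebraic closedness of the target. *)
definition algebraic_closure :: "('a :: field \<Rightarrow> 'b :: alg_closed_field) \<Rightarrow> bool" where
  "algebraic_closure f \<longleftrightarrow>
     field_embedding f \<and> (\<forall>y. \<exists>P. P \<noteq> 0 \<and> poly (map_poly f P) y = 0)"

(* Valuations with values in the real numbers extended by infinity; the value -infinity of
   the type ereal is excluded. *)
definition valuation :: "('a :: field \<Rightarrow> ereal) \<Rightarrow> bool" where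
  "valuation v \<longleftrightarrow>
     (\<forall>x. v x \<noteq> -\<infinity>) \<and> (\<forall>x. v x = \<infinity> \<longleftrightarrow> x = 0) \<and>
     (\<forall>x y. v (x * y) = v x + v y) \<and> (\<forall>x y. min (v x) (v y) \<le> v (x + y))"

definition rat_padic_valuation :: "nat \<Rightarrow> rat \<Rightarrow> ereal" where
  "rat_padic_valuation p r =
     (if r = 0 then \<infinity>
      else ereal (real (multiplicity (int p) (fst (quotient_of r)))
                  - real (multiplicity (int p) (snd (quotient_of r)))))"

(* A sequence is small in the topology of a valuation v when its values under v tend to
   infinity; hence the order of the inequalities below. *)
definition valuation_complete :: "('a :: field \<Rightarrow> ereal) \<Rightarrow> bool" where
  "valuation_complete v \<longleftrightarrow>
     (\<forall>X :: nat \<Rightarrow> 'a.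
        (\<forall>C::real. \<exists>N. \<forall>m\<ge>N. \<forall>n\<ge>N. ereal C < v (X m - X n)) \<longrightarrow>
        (\<exists>L. \<forall>C::real. \<exists>N. \<forall>n\<ge>N. ereal C < v (X n - L)))"

(* The type 'a with valuation v is a model of the field of p-adic numbers, i.e. a completion
   of the rational numbers with respect to the p-adic valuation. *)
definition padic_field :: "nat \<Rightarrow> ('a :: field_char_0 \<Rightarrow> ereal) \<Rightarrow> bool" where
  "padic_field p v \<longleftrightarrow>
     valuation v \<and> (\<forall>r. v (of_rat r) = rat_padic_valuation p r) \<and>
     valuation_complete v \<and> (\<forall>x. \<forall>C::real. \<exists>r. ereal C < v (x - of_rat r))"

(* Used with an algebraically closed 'a, so that the roots of B' in 'a are all the critical
   points of B. *)
definition belyi_polynomial :: "'a :: field poly \<Rightarrow> bool" where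
  "belyi_polynomial B \<longleftrightarrow>
     0 < degree B \<and> poly B 0 \<in> {0, 1} \<and> poly B 1 \<in> {0, 1} \<and>
     {poly B x | x. poly (pderiv B) x = 0} \<subseteq> {0, 1}"

definition belyi_height :: "'a :: field \<Rightarrow> nat" where
  "belyi_height l = (LEAST d. \<exists>B. belyi_polynomial B \<and> poly B l \<in> {0, 1} \<and> degree B = d)"

end

theory Submission
  imports Defs
begin

text \<open>
  Let \<open>B\<close> be a Belyi polynomial of degree \<open>n < p\<close> and \<open>S = B\<^sup>-\<^sup>1{0, 1}\<close>. Counting critical points
  gives \<open>card S = n + 1\<close>. After an affine change of variable, all points of \<open>S\<close> are integral
  and two of them have distinct residues. Call the points of \<open>S\<close> with a given residue a
  cluster. As \<open>n < p\<close>, differentiation lowers the order of a zero of the reduction by exactly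
  one. Let \<open>c\<close> be the leading coefficient of the rescaled polynomial. If \<open>c\<close> is not
  integral, \<open>B / c\<close> and \<open>(B - 1) / c\<close> have the same reduction, and a cluster where it vanishes to
  order \<open>m\<close> has \<open>m + 1\<close> points; summing over the clusters, there is only one, a contradiction.
  Otherwise \<open>c\<close> is a unit and every cluster is a single point. So the distances between points
  of \<open>S\<close> are all equal, hence equal to that of \<open>0\<close> and \<open>1\<close>, and every nonzero point of \<open>S\<close> is
  a unit. As the height is a least element, Belyi's construction is needed to know that it is
  attained.
\<close>

section \<open>Roots and their orders over an algebraically closed field\<close>

text \<open>A root can be split off as long as the degree is positive, and the cofactor stays monic.
  This replaces working with an explicit product of linear factors.\<close>

lemma monic_split_induct [consumes 1, case_names one mult]:
  fixes P :: "'a :: alg_closed_field poly"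
  assumes "lead_coeff P = 1"
    and "R 1"
    and "\<And>a q. lead_coeff q = 1 \<Longrightarrow> R q \<Longrightarrow> R ([:-a, 1:] * q)"
  shows "R P"
  using assms(1)
proof (induction "degree P" arbitrary: P)
  case 0
  then have "P = 1"
    by (auto elim!: degree_eq_zeroE simp: one_pCons)
  then show ?case using assms(2) by simp
next
  case (Suc n)
  obtain a where "poly P a = 0"
    using Suc.hyps(2) alg_closed_imp_poly_has_root[of P] by auto
  then obtain q where q: "P = [:-a, 1:] * q"
    by (meson dvdE poly_eq_0_iff_dvd)
  have lq: "lead_coeff q = 1"
    using Suc.prems unfolding q lead_coeff_mult by simp
  then have "q \<noteq> 0" by auto
  then have "degree P = Suc (degree q)"
    unfolding q by (subst degree_mult_eq) auto
  then show ?case using Suc.hyps lq assms(3) q by auto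
qed

lemma order_linear_mult:
  fixes q :: "'a :: idom poly"
  assumes "q \<noteq> 0"
  shows "order x ([:-a, 1:] * q) = (if x = a then 1 else 0) + order x q"
proof -
  have "order x [:-a, 1:] = (if x = a then 1 else 0)"
    using order_power_n_n[of a 1] by (auto intro: order_0I)
  moreover have "[:-a, 1:] * q \<noteq> 0"
    using assms by (simp del: mult_pCons_left)
  ultimately show ?thesis using order_mult[of "[:-a, 1:]" q x] by presburger
qed

text \<open>Splitting off \<open>[:-a, 1:]\<close> raises both sides by one. Points of
  \<open>S\<close> that are not roots contribute order 0, so one set \<open>S\<close> can serve
  several polynomials.\<close>

lemma sum_order_eq_degree:
  fixes P :: "'a :: alg_closed_field poly"
  assumes "P \<noteq> 0" "finite S" "{x. poly P x = 0} \<subseteq> S"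
  shows "(\<Sum>x\<in>S. order x P) = degree P"
proof -
  define M where "M = smult (inverse (lead_coeff P)) P"
  have "lead_coeff M = 1" using assms(1) by (simp add: M_def)
  moreover have "{x. poly M x = 0} \<subseteq> S" using assms(1,3) by (simp add: M_def)
  ultimately have "(\<Sum>x\<in>S. order x M) = degree M"
  proof (induction M rule: monic_split_induct)
    case one
    then show ?case by simp
  next
    case (mult a q)
    then have "q \<noteq> 0" "a \<in> S" by auto
    moreover have "{x. poly q x = 0} \<subseteq> S" using mult.prems by auto
    ultimately show ?case
      using mult.IH assms(2)
      by (simp add: order_linear_mult sum.distrib degree_mult_eq del: mult_pCons_left)
  qed
  then show ?thesis using assms(1) by (simp add: M_def order_smult)
qed

section \<open>Valuations and vanishing orders of reductions\<close>

locale valued_field =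
  fixes w :: "'a :: field \<Rightarrow> ereal"
  assumes valuation: "valuation w"
begin

lemma mult: "w (x * y) = w x + w y"
  and add: "min (w x) (w y) \<le> w (x + y)"
  and not_minus_infty: "w x \<noteq> -\<infinity>"
  and eq_infty_iff: "w x = \<infinity> \<longleftrightarrow> x = 0"
  using valuation unfolding valuation_def by blast+

lemma zero [simp]: "w 0 = \<infinity>"
  using eq_infty_iff by blast

lemma one [simp]: "w 1 = 0"
  using mult[of 1 1] not_minus_infty[of 1] eq_infty_iff[of 1] by (cases "w 1") auto

lemma minus [simp]: "w (- x) = w x"
proof -
  have "w (-1) = 0"
    using mult[of "-1" "-1"] not_minus_infty[of "-1"] eq_infty_iff[of "-1"]
    by (cases "w (-1)") auto
  then show ?thesis using mult[of "-1" x] by simp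
qed

lemma minus_commute: "w (x - y) = w (y - x)"
  by (metis minus minus_diff_eq)

lemma diff: "min (w x) (w y) \<le> w (x - y)"
  using add[of x "-y"] by simp

lemma diff_ge: "r \<le> w x \<Longrightarrow> r \<le> w y \<Longrightarrow> r \<le> w (x - y)"
  using diff[of x y] by (auto simp: min_def split: if_splits)

lemma diff_gt: "r < w x \<Longrightarrow> r < w y \<Longrightarrow> r < w (x - y)"
  using diff[of x y] by (auto simp: min_def split: if_splits)

text \<open>The strict ultrametric law: the term of smaller valuation dominates. The upper bound
  comes from writing \<open>y = x - (x - y)\<close>.\<close>

lemma diff_eq:
  assumes "w y < w x"
  shows "w (x - y) = w y"
proof (rule antisym)
  have "min (w (x - y)) (w x) \<le> w y"
    using diff[of x "x - y"] by (simp add: min.commute)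
  then show "w (x - y) \<le> w y" using assms by (auto simp: min_def split: if_splits)
  show "w y \<le> w (x - y)" using assms by (simp add: diff_ge)
qed

lemma mult_nonneg: "0 \<le> w x \<Longrightarrow> 0 \<le> w y \<Longrightarrow> 0 \<le> w (x * y)"
  by (simp add: mult)

lemma mult_pos: "0 < w x \<Longrightarrow> 0 \<le> w y \<Longrightarrow> 0 < w (x * y)"
  by (simp add: mult add_pos_nonneg)

lemma divide:
  assumes "y \<noteq> 0"
  shows "w (x / y) = w x - w y"
proof -
  have "w x = w (x / y) + w y"
    using assms mult[of "x / y" y] by simp
  then show ?thesis
    using not_minus_infty[of y] eq_infty_iff[of y] assms
    by (cases "w (x / y)"; cases "w y") auto
qed

text \<open>For a polynomial with integral coefficients, \<open>residue_order P m\<close> says that the reduction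
  of \<open>P\<close> modulo the maximal ideal vanishes to order exactly \<open>m\<close> at \<open>0\<close>; this makes the residue
  field itself unnecessary.\<close>
definition residue_order :: "'a poly \<Rightarrow> nat \<Rightarrow> bool" where
  "residue_order P m \<longleftrightarrow>
     (\<forall>i. 0 \<le> w (coeff P i)) \<and> (\<forall>i<m. 0 < w (coeff P i)) \<and> w (coeff P m) = 0"

lemma residue_order_unique: "residue_order P m \<Longrightarrow> residue_order P k \<Longrightarrow> m = k"
  unfolding residue_order_def by (metis less_irrefl linorder_neqE_nat)

lemma residue_order_smult:
  "w u = 0 \<Longrightarrow> residue_order (smult u P) m \<longleftrightarrow> residue_order P m"
  by (simp add: residue_order_def mult)

text \<open>The reduction of \<open>[:-a, 1:]\<close> vanishes at 0 exactly when \<open>a\<close>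
  has positive valuation. In that case the first unit coefficient of \<open>q\<close> is shifted up
  by one; otherwise it stays in place, multiplied by the unit \<open>a\<close>.\<close>

lemma residue_order_linear_mult:
  assumes "residue_order q m" "0 \<le> w a"
  shows "residue_order ([:-a, 1:] * q) ((if 0 < w a then 1 else 0) + m)"
proof -
  have c: "coeff ([:-a, 1:] * q) i = (case i of 0 \<Rightarrow> 0 | Suc k \<Rightarrow> coeff q k) - a * coeff q i" for i
    by (simp add: coeff_pCons split: nat.split)
  have q: "0 \<le> w (coeff q i)" "i < m \<Longrightarrow> 0 < w (coeff q i)" "w (coeff q m) = 0" for i
    using assms(1) by (auto simp: residue_order_def)
  have low: "0 \<le> w (case i of 0 \<Rightarrow> 0 | Suc k \<Rightarrow> coeff q k)"
    and low': "i \<le> m \<Longrightarrow> 0 < w (case i of 0 \<Rightarrow> 0 | Suc k \<Rightarrow> coeff q k)" for i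
    using q by (auto split: nat.split)
  have nn: "0 \<le> w (coeff ([:-a, 1:] * q) i)" for i
    unfolding c using low q(1) assms(2) by (intro diff_ge mult_nonneg)
  show ?thesis
  proof (cases "0 < w a")
    case True
    have "0 < w (coeff ([:-a, 1:] * q) i)" if "i < Suc m" for i
      unfolding c using low' that q(1) True by (intro diff_gt mult_pos) auto
    moreover have "w (coeff ([:-a, 1:] * q) (Suc m)) = 0"
    proof -
      have "w (a * coeff q (Suc m) - coeff q m) = w (coeff q m)"
        using True q by (intro diff_eq) (simp add: mult_pos)
      then show ?thesis unfolding c using q(3) by (simp add: minus_commute)
    qed
    ultimately show ?thesis using nn True by (simp add: residue_order_def)
  next
    case False
    then have a: "w a = 0" using assms(2) by simp
    have "0 < w (coeff ([:-a, 1:] * q) i)" if "i < m" for i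
      unfolding c using low'[of i] that q(2) a by (intro diff_gt) (auto simp: mult)
    moreover have "w (coeff ([:-a, 1:] * q) m) = w (a * coeff q m)"
      unfolding c using low'[of m] q(3) a by (intro diff_eq) (auto simp: mult)
    then have "w (coeff ([:-a, 1:] * q) m) = 0"
      using q(3) a by (simp add: mult)
    ultimately show ?thesis using nn False by (simp add: residue_order_def)
  qed
qed

text \<open>Since \<open>e\<close> reduces to 0, both polynomials have the same reduction.\<close>

lemma residue_order_diff_const:
  assumes "residue_order P m" "0 < w e"
  shows "residue_order (P - [:e:]) m"
proof -
  have c: "coeff (P - [:e:]) i = coeff P i - (if i = 0 then e else 0)" for i
    by (simp add: coeff_pCons split: nat.split)
  have "w (coeff P 0 - e) = 0" if "w (coeff P 0) = 0"
    using diff_eq[of "coeff P 0" e] that assms(2) by (simp add: minus_commute)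
  then show ?thesis
    using assms unfolding residue_order_def c by (auto intro: diff_ge diff_gt)
qed

text \<open>The factors produced by differentiation are units up to the degree, so coefficients only
  move down by one index and keep their valuations.\<close>

lemma residue_order_pderiv:
  assumes "residue_order P (Suc m)"
    and "\<And>k. 0 < k \<Longrightarrow> k \<le> n \<Longrightarrow> w (of_nat k) = 0" "degree P = n"
  shows "residue_order (pderiv P) m"
proof -
  have P: "0 \<le> w (coeff P i)" "i < Suc m \<Longrightarrow> 0 < w (coeff P i)" "w (coeff P (Suc m)) = 0" for i
    using assms(1) by (auto simp: residue_order_def)
  have "w (coeff (pderiv P) i) = w (coeff P (Suc i))" for i
  proof (cases "Suc i \<le> n")
    case True
    then have "w (of_nat (Suc i)) = 0" using assms(2)[of "Suc i"] by simp
    then show ?thesis by (simp only: coeff_pderiv mult) simp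
  next
    \<comment> \<open>Beyond the degree both coefficients are 0, so both valuations are
      infinite.\<close>
    case False
    then show ?thesis using assms(3) by (simp add: coeff_pderiv coeff_eq_0)
  qed
  then show ?thesis using P by (simp add: residue_order_def)
qed

end

locale alg_closed_valued_field = valued_field w
  for w :: "'a :: {alg_closed_field, field_char_0} \<Rightarrow> ereal"
begin

text \<open>After translation by \<open>z\<close>, a root \<open>x\<close> yields the factor
  \<open>[:-(x - z), 1:]\<close>, whose reduction vanishes at 0 only if \<open>x\<close> and
  \<open>z\<close> have the same residue.\<close>

lemma residue_order_monic:
  assumes "lead_coeff P = 1" "finite S" "{x. poly P x = 0} \<subseteq> S"
    and "\<And>x. x \<in> S \<Longrightarrow> 0 \<le> w x" "0 \<le> w z"
  shows "residue_order (pcompose P [:z, 1:]) (\<Sum>x | x \<in> S \<and> 0 < w (x - z). order x P)"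
  using assms(1,3)
proof (induction P rule: monic_split_induct)
  case one
  then show ?case by (simp add: pcompose_1 residue_order_def)
next
  case (mult a q)
  define C where "C = {x. x \<in> S \<and> 0 < w (x - z)}"
  have "finite C" using assms(2) by (simp add: C_def)
  have a: "a \<in> S" and "q \<noteq> 0" using mult by auto
  have e1: "pcompose ([:-a, 1:] * q) [:z, 1:] = [:-(a - z), 1:] * pcompose q [:z, 1:]"
    by (simp only: pcompose_mult) (simp add: pcompose_pCons)
  have e2: "(\<Sum>x\<in>C. order x ([:-a, 1:] * q)) =
                 (if 0 < w (a - z) then 1 else 0) + (\<Sum>x\<in>C. order x q)"
    using \<open>q \<noteq> 0\<close> \<open>finite C\<close> a
    by (simp add: order_linear_mult sum.distrib C_def del: mult_pCons_left)
  have "residue_order (pcompose q [:z, 1:]) (\<Sum>x\<in>C. order x q)"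
    unfolding C_def using mult by (intro mult.IH) auto
  then have "residue_order ([:-(a - z), 1:] * pcompose q [:z, 1:])
               ((if 0 < w (a - z) then 1 else 0) + (\<Sum>x\<in>C. order x q))"
    using a assms(4,5) by (intro residue_order_linear_mult diff_ge)
  then show ?case unfolding e1 C_def[symmetric] e2 .
qed

end

section \<open>Polynomials with critical values 0 and 1: counting points in residue classes\<close>

text \<open>In contrast to \<open>belyi_polynomial\<close>, nothing is required of the values at 0
  and 1, so the conditions survive an affine change of variable.\<close>

locale tame_shabat = alg_closed_valued_field w
  for w :: "'a :: {alg_closed_field, field_char_0} \<Rightarrow> ereal" +
  fixes F :: "'a poly"
  assumes degree_pos: "0 < degree F"
    and critical: "poly (pderiv F) x = 0 \<Longrightarrow> poly F x \<in> {0, 1}"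
    and tame: "0 < k \<Longrightarrow> k \<le> degree F \<Longrightarrow> w (of_nat k) = 0"
begin

definition S where "S = {x. poly F x \<in> {0, 1}}"

lemma degree_F1: "degree (F - [:1:]) = degree F"
  using degree_pos degree_add_eq_left[of "- [:1:]" F] by (simp del: minus_pCons)

lemma lead_coeff_F1: "lead_coeff (F - [:1:]) = lead_coeff F"
  using degree_pos unfolding degree_F1 by (simp add: coeff_pCons split: nat.split)

lemma F_nz: "F \<noteq> 0" "F - [:1:] \<noteq> 0"
  using degree_pos degree_F1 by auto

lemma pderiv_F_nz: "pderiv F \<noteq> 0"
  using degree_pos by (simp add: pderiv_eq_0_iff)

lemma pderiv_F1: "pderiv (F - [:1:]) = pderiv F"
  by (simp add: pderiv_diff pderiv_pCons)

lemma S_eq: "S = {x. poly F x = 0} \<union> {x. poly (F - [:1:]) x = 0}"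
  by (auto simp: S_def)

lemma finite_S: "finite S"
  unfolding S_eq using F_nz by (intro finite_UnI poly_roots_finite)

text \<open>At a point of \<open>S\<close> exactly one of \<open>F\<close> and
  \<open>F - [:1:]\<close> vanishes, and in characteristic 0 the derivative vanishes there to one
  order less. It is applied to all of \<open>S\<close> and to single clusters.\<close>

lemma ramification:
  assumes "D \<subseteq> S"
  shows "(\<Sum>x\<in>D. order x (pderiv F)) + card D
       = (\<Sum>x\<in>D. order x F) + (\<Sum>x\<in>D. order x (F - [:1:]))"
proof -
  have "order x (pderiv F) + 1 = order x F + order x (F - [:1:])" if "x \<in> S" for x
  proof (cases "poly F x = 0")
    case True
    then have "order x F = Suc (order x (pderiv F))" "order x (F - [:1:]) = 0"
      using order_pderiv[OF F_nz(1)] by (auto intro: order_0I)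
    then show ?thesis by simp
  next
    case False
    then have "poly (F - [:1:]) x = 0" using that by (auto simp: S_def)
    then have "order x (F - [:1:]) = Suc (order x (pderiv F))" "order x F = 0"
      using order_pderiv[OF F_nz(2)] False unfolding pderiv_F1 by (auto intro: order_0I)
    then show ?thesis by simp
  qed
  then have "(\<Sum>x\<in>D. order x (pderiv F) + 1) = (\<Sum>x\<in>D. order x F + order x (F - [:1:]))"
    using assms by (intro sum.cong) auto
  then show ?thesis by (simp only: sum.distrib) simp
qed

text \<open>Riemann-Hurwitz: all \<open>degree F - 1\<close> critical points, counted with
  multiplicity, lie in \<open>S\<close>, and the two fibres have total multiplicity
  \<open>2 * degree F\<close>.\<close>

lemma card_S: "card S = degree F + 1"
proof -
  have "(\<Sum>x\<in>S. order x F) = degree F" "(\<Sum>x\<in>S. order x (F - [:1:])) = degree F"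
    using sum_order_eq_degree[OF F_nz(1) finite_S] sum_order_eq_degree[OF F_nz(2) finite_S]
    by (auto simp: S_eq degree_F1)
  moreover have "(\<Sum>x\<in>S. order x (pderiv F)) = degree F - 1"
    using critical sum_order_eq_degree[OF pderiv_F_nz finite_S]
    by (auto simp: S_def degree_pderiv)
  ultimately show ?thesis using ramification[of S] degree_pos by simp
qed

definition cluster where "cluster z = {x \<in> S. 0 < w (x - z)}"

text \<open>The orders \<open>mA\<close>, \<open>mB\<close>, \<open>k\<close> of \<open>F\<close>,
  \<open>F - [:1:]\<close> and \<open>pderiv F\<close>, summed over a cluster, are vanishing orders
  of reductions. Tameness relates \<open>k\<close> to \<open>mA\<close> and \<open>mB\<close>, and
  \<open>ramification\<close> turns this into a count of points.\<close>

lemma cluster_props: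
  assumes "\<And>x. x \<in> S \<Longrightarrow> 0 \<le> w x" "z \<in> S"
  shows "w (lead_coeff F) \<le> 0"
    and "w (lead_coeff F) < 0 \<Longrightarrow> card (cluster z) = (\<Sum>x\<in>cluster z. order x F) + 1"
    and "w (lead_coeff F) = 0 \<Longrightarrow> card (cluster z) = 1"
proof -
  define c where "c = lead_coeff F"
  define n where "n = degree F"
  define mA where "mA = (\<Sum>x\<in>cluster z. order x F)"
  define mB where "mB = (\<Sum>x\<in>cluster z. order x (F - [:1:]))"
  define k where "k = (\<Sum>x\<in>cluster z. order x (pderiv F))"
  define X where "X = pcompose (smult (1 / c) F) [:z, 1:]"
  have c: "c \<noteq> 0" using F_nz by (simp add: c_def)
  have n: "0 < n" "(of_nat n :: 'a) \<noteq> 0" using degree_pos by (simp_all add: n_def)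
  have wz: "0 \<le> w z" using assms by blast
  have fin: "finite (cluster z)" using finite_S by (simp add: cluster_def)
  have ram: "k + card (cluster z) = mA + mB"
    unfolding k_def mA_def mB_def by (intro ramification) (auto simp: cluster_def)
  have "z \<in> cluster z" using assms(2) by (simp add: cluster_def)
  then have card: "0 < card (cluster z)" using fin card_gt_0_iff by blast
  have cl: "(\<Sum>x | x \<in> S \<and> 0 < w (x - z). f x) = (\<Sum>x\<in>cluster z. f x)" for f :: "'a \<Rightarrow> nat"
    by (simp add: cluster_def)
  have A: "residue_order X mA"
  proof -
    have "residue_order X (\<Sum>x\<in>cluster z. order x (smult (1 / c) F))"
      unfolding X_def cl[symmetric]
      by (rule residue_order_monic[OF _ finite_S _ assms(1) wz])
        (use c in \<open>auto simp: S_eq c_def\<close>)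
    then show ?thesis using c by (simp add: order_smult mA_def)
  qed
  have X1: "X - [:1 / c:] = pcompose (smult (1 / c) (F - [:1:])) [:z, 1:]"
    by (simp add: X_def pcompose_smult pcompose_diff smult_diff_right)
  have B: "residue_order (X - [:1 / c:]) mB"
  proof -
    have "residue_order (X - [:1 / c:]) (\<Sum>x\<in>cluster z. order x (smult (1 / c) (F - [:1:])))"
      unfolding X1 cl[symmetric]
      by (rule residue_order_monic[OF _ finite_S _ assms(1) wz])
        (use c lead_coeff_F1 in \<open>auto simp: S_eq c_def\<close>)
    then show ?thesis using c by (simp add: order_smult mB_def)
  qed
  have D: "residue_order (pderiv X) k"
  proof -
    \<comment> \<open>Dividing by \<open>of_nat n * c\<close> makes the derivative monic. As
      \<open>of_nat n\<close> is a unit, restoring that factor to obtain \<open>pderiv X\<close>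
      does not change the order.\<close>
    have lc: "lead_coeff (pderiv F) = of_nat n * c"
      using degree_pos by (simp add: degree_pderiv coeff_pderiv n_def c_def)
    have roots: "{x. poly (pderiv F) x = 0} \<subseteq> S" using critical by (auto simp: S_def)
    have "residue_order (pcompose (smult (1 / (of_nat n * c)) (pderiv F)) [:z, 1:])
            (\<Sum>x\<in>cluster z. order x (smult (1 / (of_nat n * c)) (pderiv F)))"
      unfolding cl[symmetric]
      by (rule residue_order_monic[OF _ finite_S _ assms(1) wz])
        (use c n lc roots in auto)
    then have "residue_order (pcompose (smult (1 / (of_nat n * c)) (pderiv F)) [:z, 1:]) k"
      using c n by (simp add: order_smult k_def)
    moreover have "pderiv X
        = smult (of_nat n) (pcompose (smult (1 / (of_nat n * c)) (pderiv F)) [:z, 1:])"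
      using n by (simp add: X_def pderiv_pcompose pderiv_smult pcompose_smult pderiv_pCons)
    moreover have "w (of_nat n) = 0" using tame[of n] n by (simp add: n_def)
    ultimately show ?thesis by (simp add: residue_order_smult)
  qed
  have degX: "degree X = n" using c by (simp add: X_def n_def degree_pcompose)
  have X0: "coeff (X - [:1 / c:]) 0 = coeff X 0 - 1 / c" by simp
  have wc: "w (1 / c) = - w c" using divide[OF c, of 1] by simp
  have tame': "\<And>k. 0 < k \<Longrightarrow> k \<le> n \<Longrightarrow> w (of_nat k) = 0" using tame by (simp add: n_def)
  have DA: "k = mA - 1" if pos: "0 < mA"
  proof -
    obtain m where m: "mA = Suc m" using pos by (cases mA) auto
    then have "residue_order (pderiv X) m"
      using residue_order_pderiv[OF _ tame' degX] A by simp
    then show ?thesis using residue_order_unique[OF D] m by simp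
  qed
  have DB: "k = mB - 1" if pos: "0 < mB"
  proof -
    obtain m where m: "mB = Suc m" using pos by (cases mB) auto
    have "degree (X - [:1 / c:]) = n"
      using degX n degree_add_eq_left[of "- [:1 / c:]" X] by (simp del: minus_pCons)
    then have "residue_order (pderiv (X - [:1 / c:])) m"
      using residue_order_pderiv[OF _ tame'] B m by simp
    then have "residue_order (pderiv X) m"
      by (simp add: pderiv_diff pderiv_pCons)
    then show ?thesis using residue_order_unique[OF D] m by simp
  qed
  \<comment> \<open>Two integral constant coefficients differ by \<open>1 / c\<close>, so
    \<open>1 / c\<close> is integral.\<close>
  have "0 \<le> w (coeff X 0)" "0 \<le> w (coeff X 0 - 1 / c)"
    using A B unfolding X0[symmetric] residue_order_def by blast+
  then have "0 \<le> w (1 / c)"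
    using diff_ge[of 0 "coeff X 0" "coeff X 0 - 1 / c"] by simp
  then show "w (lead_coeff F) \<le> 0"
    unfolding wc by (cases "w c") (auto simp: c_def)
  show "card (cluster z) = mA + 1" if "w (lead_coeff F) < 0"
  proof -
    have "0 < w (1 / c)" using that unfolding wc c_def[symmetric] by (cases "w c") auto
    then have "residue_order (X - [:1 / c:]) mA" using A by (simp add: residue_order_diff_const)
    then have "mA = mB" using B residue_order_unique by blast
    \<comment> \<open>Here \<open>mA = 0\<close> is impossible, as the right side of
      \<open>ram\<close> would be 0 and the cluster empty. So \<open>k = mA - 1\<close> is a genuine
      subtraction.\<close>
    then show ?thesis using ram card DA by linarith
  qed
  show "card (cluster z) = 1" if "w (lead_coeff F) = 0"
  proof -
    have u: "w (1 / c) = 0" using that unfolding wc c_def[symmetric] by simp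
    \<comment> \<open>If both reductions vanished at 0, so would their difference, the reduction of
      the unit \<open>1 / c\<close>.\<close>
    have "mA = 0 \<or> mB = 0"
    proof (rule ccontr)
      assume "\<not> ?thesis"
      then have "0 < w (coeff X 0)" "0 < w (coeff X 0 - 1 / c)"
        using A B unfolding X0[symmetric] residue_order_def by blast+
      then have "0 < w (1 / c)"
        using diff_gt[of 0 "coeff X 0" "coeff X 0 - 1 / c"] by simp
      then show False using u by simp
    qed
    then show ?thesis using ram card DA DB by linarith
  qed
qed

text \<open>The points \<open>s\<close> and \<open>t\<close> witness two distinct clusters. This
  rules out a leading coefficient of negative valuation, and in the remaining case clusters are
  singletons.\<close>

lemma equidistant:
  assumes int: "\<And>x. x \<in> S \<Longrightarrow> 0 \<le> w x"
    and "s \<in> S" "t \<in> S" "w (s - t) = 0"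
    and "x \<in> S" "y \<in> S" "x \<noteq> y"
  shows "w (x - y) = 0"
proof (cases "w (lead_coeff F) < 0")
  case True
  have refl: "z \<in> cluster z" if "z \<in> S" for z using that by (simp add: cluster_def)
  have trans: "0 < w (u - z)" if "0 < w (u - v)" "0 < w (v - z)" for u v z
    using diff_gt[of 0 "u - v" "z - v"] that by (simp add: minus_commute)
  \<comment> \<open>Clusters are the classes of an equivalence relation, so sums over
    \<open>S\<close> can be grouped by them.\<close>
  have fib: "{u \<in> S. cluster u = cluster z} = cluster z" if "z \<in> S" for z
  proof (intro equalityI subsetI)
    fix u assume "u \<in> {u \<in> S. cluster u = cluster z}"
    then show "u \<in> cluster z" using refl by blast
  next
    fix u assume u: "u \<in> cluster z"
    then have "0 < w (u - z)" "0 < w (z - u)" by (auto simp: cluster_def minus_commute)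
    then have "\<And>v. 0 < w (v - u) \<longleftrightarrow> 0 < w (v - z)" using trans by blast
    then have "cluster u = cluster z" by (simp add: cluster_def)
    then show "u \<in> {u \<in> S. cluster u = cluster z}" using u by (auto simp: cluster_def)
  qed
  have group: "(\<Sum>u\<in>S. f u) = (\<Sum>C\<in>cluster ` S. \<Sum>u\<in>C. f u)" for f :: "'a \<Rightarrow> nat"
  proof -
    have "(\<Sum>u\<in>S. f u) = (\<Sum>C\<in>cluster ` S. \<Sum>u\<in>{u \<in> S. cluster u = C}. f u)"
      by (rule sum.image_gen[OF finite_S])
    also have "\<dots> = (\<Sum>C\<in>cluster ` S. \<Sum>u\<in>C. f u)"
      by (rule sum.cong) (use fib in auto)
    finally show ?thesis .
  qed
  have "card S = (\<Sum>C\<in>cluster ` S. card C)" unfolding card_eq_sum by (rule group)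
  also have "\<dots> = (\<Sum>C\<in>cluster ` S. (\<Sum>u\<in>C. order u F) + 1)"
    using cluster_props(2)[OF int _ True] by (intro sum.cong) auto
  also have "\<dots> = (\<Sum>u\<in>S. order u F) + card (cluster ` S)"
    by (simp only: sum.distrib group) simp
  also have "(\<Sum>u\<in>S. order u F) = degree F"
    using sum_order_eq_degree[OF F_nz(1) finite_S] by (simp add: S_eq)
  \<comment> \<open>Each cluster has one point more than its share of the degree, whereas
    \<open>S\<close> has only one point more in total.\<close>
  finally have "card (cluster ` S) = 1" using card_S by simp
  then have "cluster s = cluster t" using assms(2,3) by (metis card_1_singletonE imageI singletonD)
  then have "s \<in> cluster t" using refl assms(2) by blast
  then show ?thesis using assms(4) by (simp add: cluster_def)
next
  case False
  then have "w (lead_coeff F) = 0" using cluster_props(1)[OF int assms(2)] by simp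
  then have "card (cluster y) = 1" using cluster_props(3)[OF int assms(6)] by simp
  moreover have "y \<in> cluster y" using assms(6) by (simp add: cluster_def)
  ultimately have "x \<notin> cluster y" using assms(7) by (metis card_1_singletonE singletonD)
  then show ?thesis using assms(5) diff_ge[OF int int] assms(6)
    by (auto simp: cluster_def not_less intro: antisym)
qed

end

section \<open>Rescaling a Belyi polynomial\<close>

context alg_closed_valued_field
begin

text \<open>An affine map sends two points of \<open>U\<close> at maximal distance to 0 and 1, which
  makes all points integral. Then \<open>equidistant\<close> applies, and comparing the pairs
  \<open>l\<close>, 0 and 1, 0 gives the claim.\<close>

lemma belyi_point_unit:
  assumes B: "belyi_polynomial B" "poly B l \<in> {0, 1}" and l: "l \<noteq> 0"
    and tame: "\<And>k. 0 < k \<Longrightarrow> k \<le> degree B \<Longrightarrow> w (of_nat k) = 0"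
  shows "w l = 0"
proof -
  define U where "U = {x. poly B x \<in> {0, 1}}"
  have deg: "0 < degree B" using B(1) by (simp add: belyi_polynomial_def)
  have crit: "poly B x \<in> {0, 1}" if "poly (pderiv B) x = 0" for x
    using B(1) that unfolding belyi_polynomial_def by blast
  have "0 \<in> U" "1 \<in> U" "l \<in> U" using B by (auto simp: U_def belyi_polynomial_def)
  have "B \<noteq> 0" "B - [:1:] \<noteq> 0" using deg by auto
  then have "finite ({x. poly B x = 0} \<union> {x. poly (B - [:1:]) x = 0})"
    by (intro finite_UnI poly_roots_finite)
  then have "finite U" by (rule rev_finite_subset) (auto simp: U_def)
  define D where "D = {u \<in> U \<times> U. fst u \<noteq> snd u}"
  have D: "finite D" "(0, 1) \<in> D" using \<open>finite U\<close> \<open>0 \<in> U\<close> \<open>1 \<in> U\<close> by (simp_all add: D_def)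
  \<comment> \<open>Minimal valuation of the difference means maximal distance.\<close>
  define e where "e = arg_min_on (\<lambda>u. w (fst u - snd u)) D"
  have ne: "D \<noteq> {}" using D(2) by blast
  have e: "e \<in> D" unfolding e_def by (rule arg_min_if_finite(1)[OF D(1) ne])
  have e_min: "w (fst e - snd e) \<le> w (fst u - snd u)" if "u \<in> D" for u
    unfolding e_def by (rule arg_min_least[OF D(1) ne that])
  define s d where "s = snd e" and "d = fst e - snd e"
  have s: "s \<in> U" "s + d \<in> U" and d: "d \<noteq> 0"
    using e by (auto simp: D_def s_def d_def)
  have min: "w d \<le> w (x - y)" if "x \<in> U" "y \<in> U" for x y
  proof (cases "x = y")
    case False
    then show ?thesis using e_min[of "(x, y)"] that by (simp add: D_def d_def)
  qed simp
  define F where "F = pcompose B [:s, d:]"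
  have degF: "degree F = degree B" using d by (simp add: F_def degree_pcompose)
  have F: "poly F x = poly B (s + d * x)" for x by (simp add: F_def poly_pcompose mult.commute)
  interpret F: tame_shabat w F
  proof
    show "0 < degree F" using deg degF by simp
    show "poly F x \<in> {0, 1}" if "poly (pderiv F) x = 0" for x
    proof -
      have "poly (pderiv B) (s + d * x) = 0"
        using that d by (simp add: F_def pderiv_pcompose poly_pcompose pderiv_pCons mult.commute)
      then show ?thesis unfolding F by (rule crit)
    qed
    show "w (of_nat k) = 0" if "0 < k" "k \<le> degree F" for k using tame that degF by simp
  qed
  have S: "x \<in> F.S \<longleftrightarrow> s + d * x \<in> U" for x by (simp add: F.S_def F U_def)
  \<comment> \<open>As \<open>d\<close> is nonzero, \<open>w d\<close> is a real number and may be
    cancelled.\<close>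
  have sub: "w d + r \<le> w (d * x) \<Longrightarrow> r \<le> w x" for r x
    using not_minus_infty[of d] eq_infty_iff[of d] d
    by (cases "w d") (auto simp: mult ereal_add_le_add_iff)
  have unit: "0 \<le> w x" if "x \<in> F.S" for x
    using sub[of 0 x] min[of "s + d * x" s] that s(1) by (simp add: S)
  have "w (x - y) = w d" if "x \<in> U" "y \<in> U" "x \<noteq> y" for x y
  proof -
    have "w ((x - s) / d - (y - s) / d) = 0"
      \<comment> \<open>In the new coordinate, 1 and 0 stand for \<open>s + d\<close> and
        \<open>s\<close>; they supply the pair at unit distance.\<close>
      by (rule F.equidistant[OF unit, of 1 0]) (use that s d in \<open>auto simp: S\<close>)
    moreover have "x - y = d * ((x - s) / d - (y - s) / d)"
      using d by (simp add: field_simps)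
    ultimately show ?thesis by (metis add.right_neutral mult)
  qed
  from this[of l 0] this[of 1 0] show ?thesis
    using \<open>0 \<in> U\<close> \<open>1 \<in> U\<close> \<open>l \<in> U\<close> l by simp
qed

end

section \<open>Field embeddings and the valuation of small integers\<close>

lemma field_embedding_of_nat:
  assumes "field_embedding f"
  shows "f (of_nat n) = of_nat n"
proof -
  have f: "f 1 = 1" "\<And>x y. f (x + y) = f x + f y"
    using assms by (simp_all add: field_embedding_def)
  have "f 0 = 0" using f(2)[of 0 0] by (metis add.right_neutral add_left_cancel)
  then show ?thesis by (induction n) (simp_all add: f)
qed

lemma field_embedding_eq_0_iff:
  assumes "field_embedding f"
  shows "f x = 0 \<longleftrightarrow> x = 0"
proof -
  have f: "f 1 = 1" "\<And>x y. f (x + y) = f x + f y" "\<And>x y. f (x * y) = f x * f y"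
    using assms by (simp_all add: field_embedding_def)
  have "f 0 = 0" using f(2)[of 0 0] by (metis add.right_neutral add_left_cancel)
  moreover have "x = 0" if "f x = 0"
    using f(1) f(3)[of x "inverse x"] that by (cases "x = 0") auto
  ultimately show ?thesis by blast
qed

lemma valuation_comp_embedding:
  assumes "valuation \<nu>" "field_embedding f"
  shows "valuation (\<nu> \<circ> f)"
  using assms field_embedding_eq_0_iff[OF assms(2)]
  unfolding valuation_def field_embedding_def by simp

text \<open>This is the source of tameness for degrees below \<open>p\<close>.\<close>

lemma padic_valuation_of_nat_less:
  assumes "0 < k" "k < p"
  shows "rat_padic_valuation p (of_nat k) = 0"
proof -
  have "\<not> int p dvd int k" using assms by (auto dest: dvd_imp_le)
  then have "multiplicity (int p) (int k) = 0" by (rule not_dvd_imp_multiplicity_0)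
  moreover have "quotient_of (of_nat k) = (int k, 1)"
    using quotient_of_int[of "int k"] by (simp add: of_int_def)
  ultimately show ?thesis using assms by (simp add: rat_padic_valuation_def)
qed

section \<open>Elimination by linear algebra\<close>

text \<open>There are \<open>d + 1\<close> members in the span of the \<open>d\<close> monomials of
  degree below \<open>d\<close>.\<close>

lemma poly_family_dependent:
  fixes f :: "nat \<Rightarrow> 'a :: field poly"
  assumes "\<And>i k. i \<le> d \<Longrightarrow> d \<le> k \<Longrightarrow> coeff (f i) k = 0"
  shows "\<exists>u. (\<exists>i\<le>d. u i \<noteq> 0) \<and> (\<Sum>i\<le>d. smult (u i) (f i)) = 0"
proof (cases "inj_on f {..d}")
  case False
  \<comment> \<open>\<open>vs.dependent\<close> concerns sets, so a repeated member is treated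
    apart, by the relation \<open>f i - f j = 0\<close>.\<close>
  then obtain i j where ij: "i \<le> d" "j \<le> d" "i \<noteq> j" "f i = f j"
    by (auto simp: inj_on_def)
  define u where "u = (\<lambda>k. if k = i then 1 else if k = j then - 1 else 0 :: 'a)"
  have "(\<Sum>k\<le>d. smult (u k) (f k)) = (\<Sum>k\<in>{i, j}. smult (u k) (f k))"
    using ij by (intro sum.mono_neutral_right) (auto simp: u_def)
  also have "\<dots> = 0" using ij by (simp add: u_def)
  finally show ?thesis using ij(1) by (intro exI[of _ u]) (auto simp: u_def)
next
  case True
  interpret vs: vector_space "smult :: 'a \<Rightarrow> 'a poly \<Rightarrow> 'a poly"
    by unfold_locales (auto simp: smult_add_right smult_add_left)
  define T where "T = monom (1 :: 'a) ` {..<d}"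
  have T: "finite T" "card T \<le> d"
    using card_image_le[of "{..<d}" "monom (1 :: 'a)"] by (auto simp: T_def)
  have "f i \<in> vs.span T" if "i \<le> d" for i
  proof -
    have "f i = (\<Sum>k<d. monom (coeff (f i) k) k)"
      using assms[OF that] by (intro poly_eqI) (auto simp: coeff_sum)
    also have "\<dots> = (\<Sum>k<d. smult (coeff (f i) k) (monom 1 k))"
      by (simp add: smult_monom)
    also have "\<dots> \<in> vs.span T"
      by (intro vs.span_sum vs.span_scale vs.span_base) (auto simp: T_def)
    finally show ?thesis .
  qed
  then have "f ` {..d} \<subseteq> vs.span T" by auto
  moreover have "card (f ` {..d}) = Suc d" using True by (simp add: card_image)
  ultimately have "vs.dependent (f ` {..d})"
    using vs.independent_span_bound[OF T(1), of "f ` {..d}"] T(2) by linarith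
  then obtain u where "\<exists>v\<in>f ` {..d}. u v \<noteq> 0" "(\<Sum>v\<in>f ` {..d}. smult (u v) v) = 0"
    by (auto simp: vs.dependent_finite)
  then show ?thesis
    using True by (intro exI[of _ "u \<circ> f"]) (auto simp: sum.reindex)
qed

text \<open>Elimination by counting dimensions: the \<open>degree D + 1\<close> residues of the powers of \<open>P\<close>
  modulo \<open>D\<close> are linearly dependent.\<close>
lemma annihilating_pcompose:
  fixes D P :: "'a :: field poly"
  assumes "D \<noteq> 0"
  shows "\<exists>R. R \<noteq> 0 \<and> degree R \<le> degree D \<and> D dvd pcompose R P"
proof -
  define d where "d = degree D"
  have "coeff (P ^ i mod D) k = 0" if "d \<le> k" for i k
  proof (cases "P ^ i mod D = 0")
    case False
    then show ?thesis
      using degree_mod_less[OF assms, of "P ^ i"] that by (auto simp: d_def intro: coeff_eq_0)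
  qed simp
  then obtain u where u: "\<exists>i\<le>d. u i \<noteq> 0" "(\<Sum>i\<le>d. smult (u i) (P ^ i mod D)) = 0"
    using poly_family_dependent[of d "\<lambda>i. P ^ i mod D"] by auto
  define R where "R = (\<Sum>i\<le>d. monom (u i) i)"
  have R: "coeff R k = (if k \<le> d then u k else 0)" for k
    by (auto simp: R_def coeff_sum)
  have pw: "pcompose (monom c i) P = smult c (P ^ i)" for c i
    by (induction i) (auto simp: monom_0 monom_Suc pcompose_pCons mult.commute)
  have "(\<Sum>i\<in>A. smult (u i) (P ^ i)) mod D = (\<Sum>i\<in>A. smult (u i) (P ^ i mod D))" if "finite A" for A
    using that by induction (auto simp: poly_mod_add_left mod_smult_left)
  then have "pcompose R P mod D = 0"
    using u(2) by (simp add: R_def pcompose_sum pw)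
  moreover have "R \<noteq> 0" using u(1) R by (metis coeff_0)
  moreover have "degree R \<le> d" by (intro degree_le) (auto simp: R)
  ultimately show ?thesis by (auto simp: d_def dvd_eq_mod_eq_0)
qed

section \<open>Belyi's construction\<close>

abbreviation of_rat_poly :: "rat poly \<Rightarrow> 'a :: field_char_0 poly" where
  "of_rat_poly \<equiv> map_poly of_rat"

lemma of_rat_poly_mult: "of_rat_poly (P * Q) = of_rat_poly P * of_rat_poly Q"
  by (intro poly_eqI) (simp add: coeff_map_poly coeff_mult of_rat_sum of_rat_mult)

lemma of_rat_poly_add: "of_rat_poly (P + Q) = of_rat_poly P + of_rat_poly Q"
  by (intro poly_eqI) (simp add: coeff_map_poly of_rat_add)

lemma of_rat_poly_pderiv: "of_rat_poly (pderiv P) = pderiv (of_rat_poly P)"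
  by (intro poly_eqI) (simp add: coeff_map_poly coeff_pderiv of_rat_mult of_rat_add)

lemma of_rat_poly_pcompose:
  "of_rat_poly (pcompose P Q) = pcompose (of_rat_poly P) (of_rat_poly Q)"
  by (induction P) (auto simp: pcompose_pCons of_rat_poly_add of_rat_poly_mult map_poly_pCons)

lemma poly_of_rat_poly: "poly (of_rat_poly P) (of_rat x) = of_rat (poly P x)"
  by (induction P) (auto simp: map_poly_pCons of_rat_add of_rat_mult)

lemma degree_of_rat_poly: "degree (of_rat_poly P :: 'a :: field_char_0 poly) = degree P"
  by (rule degree_map_poly) simp

text \<open>Applying \<open>P\<close> itself sends its roots to \<open>0\<close>, and its critical values are roots of a
  rational polynomial of smaller degree.\<close>
lemma rational_critical_values:
  fixes P :: "rat poly"
  assumes "P \<noteq> 0"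
  shows "\<exists>f :: rat poly. 0 < degree f
    \<and> (\<forall>x :: 'a :: field_char_0. poly (of_rat_poly P) x = 0 \<longrightarrow> poly (of_rat_poly f) x \<in> \<rat>)
    \<and> (\<forall>x :: 'a. poly (pderiv (of_rat_poly f)) x = 0 \<longrightarrow> poly (of_rat_poly f) x \<in> \<rat>)"
  using assms
proof (induction "degree P" arbitrary: P rule: less_induct)
  case less
  show ?case
  proof (cases "degree P = 0")
    case True
    then obtain c where "P = [:c:]" "c \<noteq> 0"
      using less.prems by (auto elim: degree_eq_zeroE)
    \<comment> \<open>A nonzero constant has no roots and the identity has no critical points, so
      both conditions are vacuous.\<close>
    then show ?thesis
      by (intro exI[of _ "[:0, 1:]"]) (auto simp: map_poly_pCons pderiv_pCons)
  next
    case False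
    then have "pderiv P \<noteq> 0" by (simp add: pderiv_eq_0_iff)
    \<comment> \<open>\<open>R\<close> vanishes at all critical values of \<open>P\<close> and has
      smaller degree, so the induction hypothesis applies to it.\<close>
    then obtain R where R: "R \<noteq> 0" "degree R \<le> degree (pderiv P)" "pderiv P dvd pcompose R P"
      using annihilating_pcompose by blast
    then have "degree R < degree P" using False by (simp add: degree_pderiv)
    then obtain h where h: "0 < degree h"
      "\<And>x :: 'a. poly (of_rat_poly R) x = 0 \<Longrightarrow> poly (of_rat_poly h) x \<in> \<rat>"
      "\<And>x :: 'a. poly (pderiv (of_rat_poly h)) x = 0 \<Longrightarrow> poly (of_rat_poly h) x \<in> \<rat>"
      using less.hyps[of R] R(1) by blast
    define f where "f = pcompose h P"
    have f: "of_rat_poly f = pcompose (of_rat_poly h) (of_rat_poly P :: 'a poly)"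
      by (simp add: f_def of_rat_poly_pcompose)
    have "poly (of_rat_poly f) x \<in> \<rat>" if "poly (of_rat_poly P) x = 0" for x :: 'a
      using that poly_of_rat_poly[of h 0, where ?'a = 'a] by (simp add: f poly_pcompose)
    moreover have "poly (of_rat_poly f) x \<in> \<rat>"
      if x: "poly (pderiv (of_rat_poly f)) x = 0" for x :: 'a
    \<comment> \<open>By the chain rule, either \<open>x\<close> is critical for \<open>P\<close>,
      and its value is a root of \<open>R\<close>, or that value is critical for
      \<open>h\<close>.\<close>
    proof (cases "poly (pderiv (of_rat_poly P)) x = 0")
      case True
      obtain Q where "pcompose R P = pderiv P * Q" using R(3) by blast
      then have "pcompose (of_rat_poly R) (of_rat_poly P)
          = pderiv (of_rat_poly P) * (of_rat_poly Q :: 'a poly)"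
        by (metis of_rat_poly_mult of_rat_poly_pcompose of_rat_poly_pderiv)
      then have "poly (of_rat_poly R) (poly (of_rat_poly P) x) = 0"
        using True by (metis mult_zero_left poly_mult poly_pcompose)
      then show ?thesis using h(2) by (simp add: f poly_pcompose)
    next
      case False
      then have "poly (pderiv (of_rat_poly h)) (poly (of_rat_poly P) x) = 0"
        using x by (simp add: f pderiv_pcompose poly_pcompose)
      then show ?thesis using h(3) by (simp add: f poly_pcompose)
    qed
    moreover have "0 < degree f" using h(1) False by (simp add: f_def degree_pcompose)
    ultimately show ?thesis by blast
  qed
qed

text \<open>The polynomial \<open>C (x - a)\<^sup>m (x - c)\<^sup>n\<close> has its third critical point at
  \<open>b = (m c + n a) / (m + n)\<close>; it identifies \<open>a\<close> and \<open>c\<close>, so it shrinks the set of points.\<close>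
lemma belyi_map_of_rational_points:
  fixes T :: "rat set"
  assumes "finite T"
  shows "\<exists>g :: 'a :: field_char_0 poly. 0 < degree g
    \<and> (\<forall>t\<in>T. poly g (of_rat t) \<in> {0, 1})
    \<and> (\<forall>x. poly (pderiv g) x = 0 \<longrightarrow> poly g x \<in> {0, 1})"
  using assms
proof (induction "card T" arbitrary: T rule: less_induct)
  case less
  show ?case
  \<comment> \<open>This case also covers sets with fewer than two points; the affine map sending
    \<open>a\<close> to 0 and \<open>b\<close> to 1 works.\<close>
  proof (cases "\<exists>a b. a < b \<and> T \<subseteq> {a, b}")
    case True
    then obtain a b where ab: "a < b" "T \<subseteq> {a, b}" by blast
    define a' b' :: 'a where "a' = of_rat a" and "b' = of_rat b"
    have "b' - a' \<noteq> 0" using ab(1) by (simp add: a'_def b'_def)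
    then show ?thesis
      using ab(2)
      by (intro exI[of _ "[:- a' / (b' - a'), 1 / (b' - a'):]"])
        (auto simp: pderiv_pCons field_simps simp flip: a'_def b'_def)
  next
    case False
    have ne: "T \<noteq> {}"
    proof
      assume "T = {}"
      then have "(0::rat) < 1 \<and> T \<subseteq> {0, 1}" by simp
      then show False using False by blast
    qed
    define a c where "a = Min T" and "c = Max T"
    have ac: "a \<in> T" "c \<in> T" using ne less.prems by (simp_all add: a_def c_def)
    have bounds: "a \<le> t \<and> t \<le> c" if "t \<in> T" for t
      using that less.prems by (simp add: a_def c_def)
    have "a < c"
    proof (rule ccontr)
      assume "\<not> a < c"
      then have "T \<subseteq> {a, a + 1}" using bounds by force
      then show False using False by (metis less_add_one)
    qed
    then obtain b where b: "b \<in> T" "b \<noteq> a" "b \<noteq> c" using False by blast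
    then have abc: "a < b" "b < c" using bounds by (auto simp: order_less_le)
    \<comment> \<open>The exponents are numerator and denominator of
      \<open>(b - a) / (c - b)\<close>, chosen to make \<open>b\<close> a critical point.\<close>
    obtain i j where ij: "of_nat (Suc i) * (c - b) = of_nat (Suc j) * (b - a)"
    proof -
      obtain p q where pq: "(b - a) / (c - b) = Rat.Fract p q" "0 < q" by (cases "(b - a) / (c - b)") auto
      then have "0 < p" using abc by (metis diff_gt_0_iff_gt divide_pos_pos Rat.zero_less_Fract_iff)
      then have "p = int (Suc (nat (p - 1)))" "q = int (Suc (nat (q - 1)))" using pq(2) by simp_all
      then have "(b - a) / (c - b) = of_nat (Suc (nat (p - 1))) / of_nat (Suc (nat (q - 1)))"
        using pq(1) by (metis Rat.Fract_of_int_quotient of_int_of_nat_eq)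
      then have "of_nat (Suc (nat (p - 1))) * (c - b) = of_nat (Suc (nat (q - 1))) * (b - a)"
        using abc by (simp add: field_simps del: of_nat_Suc)
      then show thesis using that by blast
    qed
    \<comment> \<open>This factor normalizes the critical value at \<open>b\<close> to 1.\<close>
    define C where "C = 1 / ((b - a) ^ Suc i * (b - c) ^ Suc j)"
    define \<gamma> where "\<gamma> t = C * ((t - a) ^ Suc i * (t - c) ^ Suc j)" for t
    define a' b' c' C' :: 'a
      where "a' = of_rat a" and "b' = of_rat b" and "c' = of_rat c" and "C' = of_rat C"
    define G where "G = smult C' ([:- a', 1:] ^ Suc i * [:- c', 1:] ^ Suc j)"
    have C: "C \<noteq> 0" using abc by (simp add: C_def)
    have C': "C' \<noteq> 0" using C by (simp add: C'_def)
    have poly_G: "poly G x = C' * ((x - a') ^ Suc i * (x - c') ^ Suc j)" for x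
      by (simp add: G_def poly_power del: power_Suc)
    have G_rat: "poly G (of_rat t) = of_rat (\<gamma> t)" for t
      by (simp add: poly_G \<gamma>_def C'_def a'_def c'_def of_rat_mult of_rat_power of_rat_diff del: power_Suc)
    have \<gamma>: "\<gamma> a = 0" "\<gamma> c = 0" "\<gamma> b = 1" using abc by (simp_all add: \<gamma>_def C_def)
    have deg_G: "0 < degree G"
      using C' by (simp add: G_def degree_mult_eq degree_power_eq del: power_Suc)
    have crit: "poly G x \<in> {0, 1}" if x: "poly (pderiv G) x = 0" for x
    proof -
      have "poly (pderiv G) x = C' * ((x - a') ^ i * (x - c') ^ j
          * (of_nat (Suc i) * (x - c') + of_nat (Suc j) * (x - a')))"
        unfolding G_def pderiv_smult pderiv_mult pderiv_power_Suc
        by (simp add: pderiv_pCons poly_power algebra_simps)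
      then consider "x = a'" | "x = c'" | "of_nat (Suc i) * (x - c') + of_nat (Suc j) * (x - a') = 0"
        using x C' by auto
      then show ?thesis
      proof cases
        case 3
        have "of_nat (Suc i) * (c' - b') = of_nat (Suc j) * (b' - a')"
          using arg_cong[OF ij, of "of_rat :: rat \<Rightarrow> 'a"]
          unfolding of_rat_mult of_rat_diff of_rat_of_nat_eq a'_def b'_def c'_def .
        \<comment> \<open>Adding the two relations eliminates \<open>a'\<close> and
          \<open>c'\<close>.\<close>
        with 3 have "of_nat (Suc i + Suc j) * (x - b') = 0"
          unfolding of_nat_add by (simp add: algebra_simps del: of_nat_Suc)
        then have "x = b'" by (simp del: of_nat_add of_nat_Suc)
        then show ?thesis using G_rat[of b] \<gamma> by (simp add: b'_def)
      qed (simp_all add: poly_G)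
    qed
    define T' where "T' = \<gamma> ` T"
    have "\<gamma> c \<in> \<gamma> ` (T - {c})"
      using \<gamma>(1,2) ac(1) \<open>a < c\<close> by (intro image_eqI[of _ _ a]) auto
    then have "T' = \<gamma> ` (T - {c})" unfolding T'_def by blast
    then have "card T' \<le> card (T - {c})" using less.prems by (simp add: card_image_le)
    also have "\<dots> < card T" using ac less.prems by (intro psubset_card_mono) auto
    finally have "card T' < card T" .
    moreover have "finite T'" using less.prems by (simp add: T'_def)
    ultimately obtain h :: "'a poly" where h: "0 < degree h"
      "\<And>t. t \<in> T' \<Longrightarrow> poly h (of_rat t) \<in> {0, 1}"
      "\<And>x. poly (pderiv h) x = 0 \<Longrightarrow> poly h x \<in> {0, 1}"
      using less.hyps[of T'] by blast
    \<comment> \<open>The critical values 0 and 1 of \<open>G\<close> are themselves in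
      \<open>T'\<close>, so \<open>h\<close> keeps them in \<open>{0, 1}\<close>.\<close>
    have "0 \<in> T'" "1 \<in> T'" using \<gamma> ac(1) b(1) unfolding T'_def by (metis image_eqI)+
    then have h01: "poly h 0 \<in> {0, 1}" "poly h 1 \<in> {0, 1}" using h(2)[of 0] h(2)[of 1] by simp_all
    define g where "g = pcompose h G"
    have "0 < degree g" using h(1) deg_G by (simp add: g_def degree_pcompose)
    moreover have "poly g (of_rat t) \<in> {0, 1}" if "t \<in> T" for t
      using h(2)[of "\<gamma> t"] that by (simp add: g_def poly_pcompose G_rat T'_def)
    moreover have "poly g x \<in> {0, 1}" if "poly (pderiv g) x = 0" for x
    proof (cases "poly (pderiv G) x = 0")
      case True
      then show ?thesis using crit[of x] h01 by (auto simp: g_def poly_pcompose)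
    next
      case False
      then show ?thesis using that h(3) by (simp add: g_def poly_pcompose pderiv_pcompose)
    qed
    ultimately show ?thesis by blast
  qed
qed

text \<open>A first map with rational coefficients makes its critical values and the image of
  \<open>l\<close> rational; a second one sends these finitely many points, and the images of 0 and
  1, into \<open>{0, 1}\<close>.\<close>

lemma belyi_polynomial_exists:
  fixes l :: "'a :: field_char_0"
  assumes "P \<noteq> 0" "poly (of_rat_poly P) l = 0"
  shows "\<exists>B. belyi_polynomial B \<and> poly B l \<in> {0, 1}"
proof -
  obtain f where f: "0 < degree f" "poly (of_rat_poly f) l \<in> \<rat>"
    "\<And>x :: 'a. poly (pderiv (of_rat_poly f)) x = 0 \<Longrightarrow> poly (of_rat_poly f) x \<in> \<rat>"
    using rational_critical_values[OF assms(1), where ?'a = 'a] assms(2) by blast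
  define \<phi> :: "'a poly" where "\<phi> = of_rat_poly f"
  have deg: "0 < degree \<phi>" using f(1) by (simp add: \<phi>_def degree_of_rat_poly)
  define V where "V = poly \<phi> ` ({x. poly (pderiv \<phi>) x = 0} \<union> {0, 1, l})"
  have "pderiv \<phi> \<noteq> 0" using deg by (simp add: pderiv_eq_0_iff)
  then have "finite V" by (simp add: V_def poly_roots_finite)
  moreover have rat: "V \<subseteq> \<rat>"
    using f(2,3) poly_of_rat_poly[of f 0, where ?'a = 'a] poly_of_rat_poly[of f 1, where ?'a = 'a]
    by (auto simp: V_def \<phi>_def)
  moreover have "inj (of_rat :: rat \<Rightarrow> 'a)" by (simp add: inj_def)
  ultimately have "finite (of_rat -` V :: rat set)" by (simp add: finite_vimageI)
  then obtain g :: "'a poly" where g: "0 < degree g"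
    "\<And>t. of_rat t \<in> V \<Longrightarrow> poly g (of_rat t) \<in> {0, 1}"
    "\<And>x. poly (pderiv g) x = 0 \<Longrightarrow> poly g x \<in> {0, 1}"
    using belyi_map_of_rational_points[where ?'a = 'a] by (metis vimageI2)
  have gV: "poly g y \<in> {0, 1}" if "y \<in> V" for y
    using g(2) rat that by (metis Rats_cases subsetD)
  define B where "B = pcompose g \<phi>"
  have "0 < degree B" using g(1) deg by (simp add: B_def degree_pcompose)
  moreover have "poly B x \<in> {0, 1}" if "x \<in> {0, 1, l}" for x
    using that gV[of "poly \<phi> x"] by (auto simp: B_def poly_pcompose V_def)
  moreover have "poly B x \<in> {0, 1}" if "poly (pderiv B) x = 0" for x
  proof (cases "poly (pderiv \<phi>) x = 0")
    case True
    then show ?thesis using gV[of "poly \<phi> x"] by (auto simp: B_def poly_pcompose V_def)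
  next
    case False
    then show ?thesis using that g(3) by (simp add: B_def poly_pcompose pderiv_pcompose)
  qed
  ultimately show ?thesis unfolding belyi_polynomial_def by blast
qed

theorem theorem3:
  fixes p :: nat
    and v :: "'qp :: field_char_0 \<Rightarrow> ereal"
    and j :: "'qp \<Rightarrow> 'qpbar :: alg_closed_field"
    and \<nu> :: "'qpbar \<Rightarrow> ereal"
    and \<iota> :: "'qbar :: {alg_closed_field, field_char_0} \<Rightarrow> 'qpbar"
    and l :: 'qbar
  assumes "prime p"
    and "padic_field p v"
    and "algebraic_closure j"
    and "valuation \<nu>" and "\<And>x. \<nu> (j x) = v x"
    and "algebraic_closure (of_rat :: rat \<Rightarrow> 'qbar)"
    and "field_embedding \<iota>"
    and "l \<noteq> 0" and "\<nu> (\<iota> l) \<noteq> 0"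
  shows "belyi_height l \<ge> p"
proof (rule ccontr)
  assume "\<not> p \<le> belyi_height l"
  then have less: "belyi_height l < p" by simp
  obtain P where "P \<noteq> 0" "poly (of_rat_poly P) l = 0"
    using assms(6) unfolding algebraic_closure_def by blast
  then have "\<exists>d B. belyi_polynomial B \<and> poly B l \<in> {0, 1} \<and> degree B = d"
    using belyi_polynomial_exists by blast
  from LeastI_ex[OF this]
  obtain B where B: "belyi_polynomial B" "poly B l \<in> {0, 1}" "degree B = belyi_height l"
    unfolding belyi_height_def by blast
  interpret alg_closed_valued_field "\<nu> \<circ> \<iota>"
    by unfold_locales (rule valuation_comp_embedding[OF assms(4,7)])
  have "(\<nu> \<circ> \<iota>) (of_nat k) = 0" if "0 < k" "k \<le> degree B" for k
  proof -
    have "field_embedding j" using assms(3) by (simp add: algebraic_closure_def)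
    \<comment> \<open>Both \<open>\<iota>\<close> and \<open>j\<close> preserve natural numbers, so
      the valuation of \<open>k\<close> can be computed in \<open>'qp\<close>.\<close>
    then have "(\<nu> \<circ> \<iota>) (of_nat k) = v (of_rat (of_nat k))"
      using assms(5)[of "of_nat k"] by (simp add: field_embedding_of_nat assms(7))
    then show ?thesis
      using assms(2) padic_valuation_of_nat_less[of k p] that B(3) less
      by (simp only: padic_field_def)
  qed
  then have "(\<nu> \<circ> \<iota>) l = 0" using belyi_point_unit B(1,2) assms(8) by blast
  then show False using assms(9) by simp
qed

end
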